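(* Let $N,M,d\ge1$ be integers, and let $s_i\in\mathbb{R}^d$ and $p_i^{(m)}\in\mathbb{R}^d$ ($1\le i\le N$, $1\le m\le M$) be non-zero vectors. Assume $\|p_i^{(m)}\|_2\le R_p$ for all $i$ and $m$. Let $$\mathcal{L}_\perp=\frac1{NM}\sum_{i=1}^N\sum_{m=1}^M\left(\frac{s_i^\top p_i^{(m)}}{\|s_i\|_2\,\|p_i^{(m)}\|_2}\right)^2 .$$ Then $$\frac1{NM}\sum_{i=1}^N\sum_{m=1}^M\left\|\operatorname{proj}_{s_i}\left(p_i^{(m)}\right)\right\|_2\le R_p\sqrt{\mathcal{L}_\perp}.$$ An analogous bound holds for projecting $s_i$ onto the direction of $p_i^{(m)}$ when $\|s_i\|_2$ is bounded: if $\|s_i\|_2\le R_s$ for all $i$, then $$\frac1{NM}\sum_{i=1}^N\sum_{m=1}^M\left\|\operatorname{proj}_{p_i^{(m)}}\left(s_i\right)\right\|_2\le R_s\sqrt{\mathcal{L}_\perp}.$$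
   Context: $N$ is the number of nodes and $M$ the number of modalities; $s_i$ is the shared representation of node $i$ and $p_i^{(m)}$ its private residual for modality $m$. For $u\ne0$, $\operatorname{proj}_u(v)=\frac{u^\top v}{\|u\|_2^2}u$ is the orthogonal projection of $v$ onto the line spanned by $u$. *)

theory Defs
  imports "HOL-Analysis.Analysis"
begin

(* The orthogonal projection of v onto the line spanned by u; meant for u \<noteq> 0
   (it is 0 when u = 0, by the convention x / 0 = 0). *)
definition proj :: "'a::real_inner \<Rightarrow> 'a \<Rightarrow> 'a" where
  "proj u v = (inner u v / (norm u)\<^sup>2) *\<^sub>R u"

(* Nodes are indexed by 1..N and modalities by 1..M; values of s and p outside these
   ranges are irrelevant. *)
definition orth_loss ::
    "nat \<Rightarrow> nat \<Rightarrow> (nat \<Rightarrow> real ^ 'd) \<Rightarrow> (nat \<Rightarrow> nat \<Rightarrow> real ^ 'd) \<Rightarrow> real" where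
  "orth_loss N M s p =
     1 / (real N * real M) *
       (\<Sum>i=1..N. \<Sum>m=1..M. (inner (s i) (p i m) / (norm (s i) * norm (p i m)))\<^sup>2)"

end

theory Submission
  imports Defs
begin

(* Each projection has length |cos| times the length of the projected vector; bounding the latter by
   R leaves the mean of |cos|, which is at most its root mean square. *)

text \<open>Both bounds are instances of \<open>mean_norm_proj_le\<close>, which treats two families
  of vectors over one index set: the squared cosine is symmetric, so exchanging the roles of s and p
  leaves the loss unchanged. \<open>sum_grid\<close> makes the pairs (node, modality) that index
  set. The analytic content is \<open>norm_proj\<close> together with Cauchy-Schwarz in the form
  \<open>mean_le_root_mean_square\<close>.\<close>

lemma norm_proj:
  fixes u v :: "'a::real_inner"
  shows "norm (proj u v) = \<bar>inner u v / (norm u * norm v)\<bar> * norm v"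
  \<comment> \<open>With a zero vector both sides vanish, as \<open>x / 0 = 0\<close>; otherwise
    norms cancel.\<close>
  by (cases "u = 0"; cases "v = 0") (simp_all add: proj_def abs_mult power2_eq_square)

text \<open>Cauchy-Schwarz against the constant family 1. If A is empty or infinite,
  \<open>card A = 0\<close> and both sides are 0.\<close>

lemma mean_le_root_mean_square:
  fixes f :: "'k \<Rightarrow> real"
  shows "sum f A / card A \<le> sqrt ((\<Sum>k\<in>A. (f k)\<^sup>2) / card A)"
proof (cases "card A = 0")
  case False
  have "(sum f A / card A)\<^sup>2 = (sum f A)\<^sup>2 / card A / card A"
    by (simp add: power2_eq_square)
  also have "\<dots> \<le> ((\<Sum>k\<in>A. (f k)\<^sup>2) * card A) / card A / card A"
    by (intro divide_right_mono sum_squared_le_sum_of_squares) simp_all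
  also have "\<dots> = (\<Sum>k\<in>A. (f k)\<^sup>2) / card A"
    using False by simp
  finally show ?thesis
    by (rule real_le_rsqrt)
qed simp

lemma mean_norm_proj_le:
  fixes u v :: "'k \<Rightarrow> 'a::real_inner"
  assumes "\<And>k. k \<in> A \<Longrightarrow> norm (v k) \<le> R"
  shows "(\<Sum>k\<in>A. norm (proj (u k) (v k))) / card A
    \<le> R * sqrt ((\<Sum>k\<in>A. (inner (u k) (v k) / (norm (u k) * norm (v k)))\<^sup>2) / card A)"
proof (cases "A = {}")
  case False
  \<comment> \<open>Any index in A gives R \<ge> norm \<ge> 0. This sign is what allows the
    inequality between means to be multiplied by R.\<close>
  then have "0 \<le> R"
    using assms norm_ge_zero order_trans by blast
  \<comment> \<open>The absolute cosine of the angle; squaring it later removes the absolute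
    value.\<close>
  define c where "c k = \<bar>inner (u k) (v k) / (norm (u k) * norm (v k))\<bar>" for k
  have "(\<Sum>k\<in>A. norm (proj (u k) (v k))) \<le> (\<Sum>k\<in>A. R * c k)"
  proof (rule sum_mono)
    fix k assume "k \<in> A"
    then show "norm (proj (u k) (v k)) \<le> R * c k"
      using mult_left_mono[OF assms, of k "c k"] by (simp add: norm_proj c_def mult.commute)
  qed
  then have "(\<Sum>k\<in>A. norm (proj (u k) (v k))) / card A \<le> R * (sum c A / card A)"
    by (simp add: divide_right_mono flip: sum_distrib_left)
  also have "\<dots> \<le> R * sqrt ((\<Sum>k\<in>A. (c k)\<^sup>2) / card A)"
    using mean_le_root_mean_square \<open>0 \<le> R\<close> by (rule mult_left_mono)
  finally show ?thesis
    by (simp only: c_def power2_abs)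
qed simp

lemma sum_grid:
  fixes f :: "nat \<Rightarrow> nat \<Rightarrow> real"
  shows "1 / (real N * real M) * (\<Sum>i=1..N. \<Sum>m=1..M. f i m)
    = (\<Sum>k\<in>{1..N} \<times> {1..M}. f (fst k) (snd k)) / card ({1..N} \<times> {1..M})"
  by (simp add: sum.cartesian_product case_prod_beta)

theorem proposition4:
  fixes N M :: nat
    and s :: "nat \<Rightarrow> real ^ 'd"
    and p :: "nat \<Rightarrow> nat \<Rightarrow> real ^ 'd"
    and R\<^sub>p :: real
  assumes "N \<ge> 1" and "M \<ge> 1"
    and "\<And>i. i \<in> {1..N} \<Longrightarrow> s i \<noteq> 0"
    and "\<And>i m. i \<in> {1..N} \<Longrightarrow> m \<in> {1..M} \<Longrightarrow> p i m \<noteq> 0"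
    and "\<And>i m. i \<in> {1..N} \<Longrightarrow> m \<in> {1..M} \<Longrightarrow> norm (p i m) \<le> R\<^sub>p"
  shows "1 / (real N * real M) * (\<Sum>i=1..N. \<Sum>m=1..M. norm (proj (s i) (p i m)))
           \<le> R\<^sub>p * sqrt (orth_loss N M s p)
       \<and> (\<forall>R\<^sub>s. (\<forall>i\<in>{1..N}. norm (s i) \<le> R\<^sub>s) \<longrightarrow>
           1 / (real N * real M) * (\<Sum>i=1..N. \<Sum>m=1..M. norm (proj (p i m) (s i)))
             \<le> R\<^sub>s * sqrt (orth_loss N M s p))"
proof (intro conjI allI impI)
  show "1 / (real N * real M) * (\<Sum>i=1..N. \<Sum>m=1..M. norm (proj (s i) (p i m)))
      \<le> R\<^sub>p * sqrt (orth_loss N M s p)"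
    unfolding orth_loss_def sum_grid
    by (rule mean_norm_proj_le) (use assms(5) in auto)
next
  fix R\<^sub>s :: real
  assume "\<forall>i\<in>{1..N}. norm (s i) \<le> R\<^sub>s"
  then have "(\<Sum>k\<in>{1..N} \<times> {1..M}. norm (proj (p (fst k) (snd k)) (s (fst k)))) / card ({1..N} \<times> {1..M})
      \<le> R\<^sub>s * sqrt ((\<Sum>k\<in>{1..N} \<times> {1..M}. (inner (p (fst k) (snd k)) (s (fst k))
          / (norm (p (fst k) (snd k)) * norm (s (fst k))))\<^sup>2) / card ({1..N} \<times> {1..M}))"
    by (intro mean_norm_proj_le) auto
  then show "1 / (real N * real M) * (\<Sum>i=1..N. \<Sum>m=1..M. norm (proj (p i m) (s i)))
      \<le> R\<^sub>s * sqrt (orth_loss N M s p)"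
    unfolding orth_loss_def sum_grid
    \<comment> \<open>Symmetry of the cosine: swapping the arguments turns the mean square for (p,
      s) into the loss.\<close>
    by (simp only: inner_commute[of "p _ _"] mult.commute[of "norm (p _ _)"])
qed

end
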